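(* Let $\mathbb{K}_0 \subset \mathbb{V}$ be a cone and let $H^0, Q^0 \in \mathbb{V}$. Assume Condition I$_0$: $G(\mathbb{K}_0,1) \neq \emptyset$ and $0 \neq H^0 \in \mathbb{K}_0^*$. Then: (i) $G(\mathrm{co}\,\mathbb{K}_0,1) = \mathrm{co}\,G(\mathbb{K}_0,1) + \mathrm{co}\,G(\mathbb{K}_0,0)$ (Minkowski sum). (ii) $\zeta(\mathrm{co}\,\mathbb{K}_0,Q^0,1) = \zeta(\mathbb{K}_0,Q^0,1) + \zeta(\mathbb{K}_0,Q^0,0)$. (iii) $\zeta(\mathrm{co}\,\mathbb{K}_0,Q^0,1) = \zeta(\mathbb{K}_0,Q^0,1)$ if and only if at least one of the following holds: Condition II$_0$, i.e. $\zeta(\mathbb{K}_0,Q^0,0) \geq 0$; or $\zeta(\mathbb{K}_0,Q^0,1) = -\infty$.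
   Context: $\mathbb{V}$ is a finite-dimensional real vector space with inner product $\langle\cdot,\cdot\rangle$. A set $\mathbb{K}\subset\mathbb{V}$ is a cone (not necessarily convex or closed) if $\lambda A\in\mathbb{K}$ for every $A\in\mathbb{K}$ and every $\lambda\ge 0$. $\mathrm{co}$ denotes the convex hull. The dual of a cone $\mathbb{K}$ is $\mathbb{K}^*=\{Y\in\mathbb{V}:\langle Y,X\rangle\ge 0 \text{ for every } X\in\mathbb{K}\}$. With $H^0\in\mathbb{V}$ fixed, for a cone $\mathbb{K}\subset\mathbb{V}$, $P\in\mathbb{V}$ and $\rho\ge 0$, define $G(\mathbb{K},\rho)=\{X\in\mathbb{K}:\langle H^0,X\rangle=\rho\}$ and $\zeta(\mathbb{K},P,\rho)=\inf\{\langle P,X\rangle: X\in G(\mathbb{K},\rho)\}$, an extended real number, with $\zeta(\mathbb{K},P,\rho)=+\infty$ if $G(\mathbb{K},\rho)=\emptyset$. *)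

theory Defs
  imports "HOL-Analysis.Analysis"
begin

text \<open>The library predicate \<^const>\<open>cone\<close> is closure under scaling by
  all nonnegative reals, without convexity or closedness.\<close>

definition dual_cone :: "'a::real_inner set \<Rightarrow> 'a set" where
  "dual_cone K = {Y. \<forall>X\<in>K. 0 \<le> inner Y X}"

definition G :: "'a::real_inner \<Rightarrow> 'a set \<Rightarrow> real \<Rightarrow> 'a set" where
  "G H0 K \<rho> = {X \<in> K. inner H0 X = \<rho>}"

text \<open>The infimum is taken in \<^typ>\<open>ereal\<close>, so it is \<open>\<infinity>\<close> over an empty set.\<close>

definition zeta :: "'a::real_inner \<Rightarrow> 'a set \<Rightarrow> 'a \<Rightarrow> real \<Rightarrow> ereal" where
  "zeta H0 K P \<rho> = (INF X \<in> G H0 K \<rho>. ereal (inner P X))"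

end

theory Submission
  imports Defs
begin

text \<open>Every element of \<open>co K\<close> has the form \<open>t A + B\<close> with \<open>t \<ge> 0\<close>, \<open>A \<in> co G(K,1)\<close> and
  \<open>B \<in> co G(K,0)\<close>, because the set of these points is convex and contains \<open>K\<close> by scaling.
  Pairing with \<open>H\<^sup>0\<close> reads off \<open>t\<close>, which gives (i). A linear function has the same infimum on a
  set as on its convex hull, and \<open>\<zeta>(K,P,0)\<close> is the infimum of a linear function over a cone,
  hence \<open>0\<close> or \<open>-\<infinity>\<close>; this yields (ii) and (iii).\<close>

lemma G_mono: "K \<subseteq> L \<Longrightarrow> G H K \<rho> \<subseteq> G H L \<rho>"
  by (auto simp: G_def)

lemma convex_G:
  assumes "convex K"
  shows "convex (G H K \<rho>)"
proof -
  have "G H K \<rho> = K \<inter> {x. inner H x = \<rho>}"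
    by (auto simp: G_def)
  then show ?thesis
    using assms by (simp add: convex_Int convex_hyperplane)
qed

lemma cone_G_0: "cone K \<Longrightarrow> cone (G H K 0)"
  by (auto simp: G_def cone_def)

lemma hull_G_subset: "convex hull (G H K \<rho>) \<subseteq> G H (convex hull K) \<rho>"
  by (intro hull_minimal G_mono convex_G hull_subset convex_convex_hull)

text \<open>The coefficient \<open>t\<close> has to stay free: with \<open>t = 1\<close> every point
  on the right would pair to 1 with \<open>H\<close>, which excludes \<open>0\<close>, a point of
  \<open>K\<close>.\<close>

lemma convex_hull_subset_scaled_slice_plus:
  fixes K :: "'a::real_inner set"
  assumes "cone K" and "G H K 1 \<noteq> {}" and "H \<in> dual_cone K"
  shows "convex hull K \<subseteq>
    {t *\<^sub>R a + b | t a b. 0 \<le> t \<and> a \<in> convex hull (G H K 1) \<and> b \<in> convex hull (G H K 0)}"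
    (is "_ \<subseteq> ?T")
proof (rule hull_minimal)
  obtain a0 where a0: "a0 \<in> G H K 1"
    using assms(2) by blast
  then have a0': "a0 \<in> convex hull (G H K 1)"
    by (rule hull_inc)
  have "0 \<in> K"
    using a0 assms(1) cone_contains_0[of K] by (auto simp: G_def)
  then have "0 \<in> G H K 0"
    by (simp add: G_def)
  then have zero: "0 \<in> convex hull (G H K 0)"
    by (rule hull_inc)
  show "K \<subseteq> ?T"
  proof
    fix x assume x: "x \<in> K"
    define c where "c = inner H x"
    have "c \<ge> 0"
      using assms(3) x by (simp add: dual_cone_def c_def)
    then consider "c > 0" | "c = 0"
      by linarith
    then show "x \<in> ?T"
    proof cases
      case 1
      then have "(1 / c) *\<^sub>R x \<in> K"
        using x assms(1) by (simp add: cone_def)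
      then have "(1 / c) *\<^sub>R x \<in> G H K 1"
        using 1 by (simp add: G_def c_def)
      then have "(1 / c) *\<^sub>R x \<in> convex hull (G H K 1)"
        by (rule hull_inc)
      moreover have "x = c *\<^sub>R ((1 / c) *\<^sub>R x) + 0"
        using 1 by simp
      ultimately show ?thesis
        using zero \<open>c \<ge> 0\<close> by blast
    next
      case 2
      then have "x \<in> G H K 0"
        using x by (simp add: G_def c_def)
      then have "x \<in> convex hull (G H K 0)"
        by (rule hull_inc)
      \<comment> \<open>A point of the null slice has coefficient 0, so any point of the slice at
        height 1 can fill the first summand.\<close>
      moreover have "x = 0 *\<^sub>R a0 + x"
        by simp
      ultimately show ?thesis
        using a0' by blast
    qed
  qed
  show "convex ?T"
  proof (rule convexI)
    fix x y and u v :: real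
    assume x: "x \<in> ?T" and y: "y \<in> ?T" and uv: "0 \<le> u" "0 \<le> v" "u + v = 1"
    obtain t a b where t: "0 \<le> t" "a \<in> convex hull (G H K 1)" "b \<in> convex hull (G H K 0)"
      "x = t *\<^sub>R a + b"
      using x by blast
    obtain s c d where s: "0 \<le> s" "c \<in> convex hull (G H K 1)" "d \<in> convex hull (G H K 0)"
      "y = s *\<^sub>R c + d"
      using y by blast
    define w where "w = u * t + v * s"
    have "w \<ge> 0" "u * t \<ge> 0" "v * s \<ge> 0"
      using uv t s by (auto simp: w_def)
    \<comment> \<open>A nonnegative combination of two points of a convex set is \<open>w\<close>
      times a point of that set, where \<open>w\<close> is the total weight: divide the weights by
      \<open>w\<close>. If \<open>w = 0\<close>, both weights vanish and any point will do.\<close>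
    have "\<exists>e \<in> convex hull (G H K 1). (u * t) *\<^sub>R a + (v * s) *\<^sub>R c = w *\<^sub>R e"
    proof (cases "w = 0")
      case True
      then have "u * t = 0" "v * s = 0"
        using \<open>u * t \<ge> 0\<close> \<open>v * s \<ge> 0\<close> unfolding w_def by linarith+
      then show ?thesis
        using True a0' by (intro bexI[of _ a0]) auto
    next
      case False
      have "(u * t / w) *\<^sub>R a + (v * s / w) *\<^sub>R c \<in> convex hull (G H K 1)"
      proof (rule convexD[OF convex_convex_hull t(2) s(2)])
        show "u * t / w + v * s / w = 1"
          using False by (simp add: w_def flip: add_divide_distrib)
      qed (use \<open>w \<ge> 0\<close> \<open>u * t \<ge> 0\<close> \<open>v * s \<ge> 0\<close> in simp_all)
      moreover have "(u * t) *\<^sub>R a + (v * s) *\<^sub>R c = w *\<^sub>R ((u * t / w) *\<^sub>R a + (v * s / w) *\<^sub>R c)"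
        using False by (simp add: scaleR_add_right)
      ultimately show ?thesis
        by blast
    qed
    then obtain e where e: "e \<in> convex hull (G H K 1)"
      "(u * t) *\<^sub>R a + (v * s) *\<^sub>R c = w *\<^sub>R e"
      by blast
    have "u *\<^sub>R x + v *\<^sub>R y = ((u * t) *\<^sub>R a + (v * s) *\<^sub>R c) + (u *\<^sub>R b + v *\<^sub>R d)"
      by (simp add: t(4) s(4) scaleR_add_right)
    then have "u *\<^sub>R x + v *\<^sub>R y = w *\<^sub>R e + (u *\<^sub>R b + v *\<^sub>R d)"
      by (simp only: e(2))
    moreover have "u *\<^sub>R b + v *\<^sub>R d \<in> convex hull (G H K 0)"
      by (rule convexD[OF convex_convex_hull t(3) s(3) uv])
    ultimately show "u *\<^sub>R x + v *\<^sub>R y \<in> ?T"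
      using e(1) \<open>w \<ge> 0\<close> by blast
  qed
qed

lemma G_convex_hull_1:
  fixes K :: "'a::real_inner set"
  assumes "cone K" and "G H K 1 \<noteq> {}" and "H \<in> dual_cone K"
  shows "G H (convex hull K) 1 = convex hull (G H K 1) + convex hull (G H K 0)"
proof
  have hull: "inner H y = \<rho>" if "y \<in> convex hull (G H K \<rho>)" for y \<rho>
    using that hull_G_subset[of H K \<rho>] by (auto simp: G_def)
  show "G H (convex hull K) 1 \<subseteq> convex hull (G H K 1) + convex hull (G H K 0)"
  proof
    fix x assume "x \<in> G H (convex hull K) 1"
    then have x: "x \<in> convex hull K" "inner H x = 1"
      by (auto simp: G_def)
    obtain t a b where t: "a \<in> convex hull (G H K 1)" "b \<in> convex hull (G H K 0)"
      "x = t *\<^sub>R a + b"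
      using x(1) convex_hull_subset_scaled_slice_plus[OF assms] by blast
    have "t = 1"
      using x(2) hull[OF t(1)] hull[OF t(2)] by (simp add: t(3) inner_add_right)
    then show "x \<in> convex hull (G H K 1) + convex hull (G H K 0)"
      using t by (auto intro: set_plus_intro)
  qed
  have cc: "convex (convex hull K) \<and> cone (convex hull K)"
    using assms(1) by (simp add: convex_convex_hull cone_convex_hull)
  \<comment> \<open>A convex cone is closed under addition. The sum of a point at height 1 and one
    at height 0 thus stays in the hull, at height 1.\<close>
  have "a + b \<in> convex hull K" if "a \<in> convex hull K" "b \<in> convex hull K" for a b
    using cc that unfolding convex_cone by blast
  then show "convex hull (G H K 1) + convex hull (G H K 0) \<subseteq> G H (convex hull K) 1"
    using hull_G_subset[of H K 1] hull_G_subset[of H K 0]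
    by (fastforce simp: G_def set_plus_def inner_add_right)
qed

text \<open>The points where the linear function is at least its infimum over \<open>S\<close> form
  a half-space, or the whole space or the empty set when the infimum is infinite. In each case this
  set is convex and contains \<open>S\<close>.\<close>

lemma INF_inner_le_convex_hull:
  assumes "x \<in> convex hull S"
  shows "(INF y\<in>S. ereal (inner P y)) \<le> ereal (inner P x)"
proof -
  let ?m = "INF y\<in>S. ereal (inner P y)"
  have "convex {y. ?m \<le> ereal (inner P y)}"
    by (cases ?m) (simp_all add: convex_halfspace_ge)
  then have "convex hull S \<subseteq> {y. ?m \<le> ereal (inner P y)}"
    by (intro hull_minimal) (auto intro: INF_lower)
  then show ?thesis
    using assms by auto
qed

text \<open>Either the vertex 0 attains the infimum, or some point has a negative value and its
  multiples push the infimum below every real.\<close>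

lemma INF_inner_cone:
  assumes "cone S" and "S \<noteq> {}"
  shows "(INF x\<in>S. ereal (inner P x)) = (if \<forall>x\<in>S. 0 \<le> inner P x then 0 else -\<infinity>)"
    (is "?m = _")
proof (cases "\<forall>x\<in>S. 0 \<le> inner P x")
  case True
  have "0 \<in> S"
    using assms by (simp add: cone_contains_0)
  then have "?m \<le> 0"
    by (auto intro: INF_lower2[of 0])
  moreover have "0 \<le> ?m"
    using True by (auto intro: INF_greatest)
  ultimately show ?thesis
    using True by auto
next
  case False
  then obtain x where x: "x \<in> S" "inner P x < 0"
    by force
  have "?m \<le> ereal r" for r
  proof -
    \<comment> \<open>Since \<open>inner P x\<close> is negative, \<open>t * inner P x\<close> is at
      most \<open>r\<close> as soon as \<open>t\<close> is at least \<open>r / inner P x\<close>.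
      The maximum with 0 makes \<open>t\<close> an admissible scaling of the cone.\<close>
    define t where "t = max 0 (r / inner P x)"
    have "t *\<^sub>R x \<in> S"
      using assms(1) x(1) by (simp add: cone_def t_def)
    moreover have "inner P (t *\<^sub>R x) \<le> r"
    proof -
      have "t \<ge> r / inner P x"
        by (simp add: t_def)
      then show ?thesis
        using x(2) by (simp add: divide_le_eq)
    qed
    ultimately show ?thesis
      by (auto intro: INF_lower2)
  qed
  then have "?m = -\<infinity>"
    by (rule ereal_bot)
  then show ?thesis
    using False by simp
qed

theorem theorem3p2:
  fixes K0 :: "'v::euclidean_space set" and H0 Q0 :: 'v
  assumes "cone K0"
    and "G H0 K0 1 \<noteq> {}"
    and "H0 \<noteq> 0"
    and "H0 \<in> dual_cone K0"
  shows "G H0 (convex hull K0) 1 = (convex hull (G H0 K0 1)) + (convex hull (G H0 K0 0))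
    \<and> zeta H0 (convex hull K0) Q0 1 = zeta H0 K0 Q0 1 + zeta H0 K0 Q0 0
    \<and> (zeta H0 (convex hull K0) Q0 1 = zeta H0 K0 Q0 1 \<longleftrightarrow>
         zeta H0 K0 Q0 0 \<ge> 0 \<or> zeta H0 K0 Q0 1 = - \<infinity>)"
proof -
  let ?zhull = "zeta H0 (convex hull K0) Q0 1"
  let ?zone = "zeta H0 K0 Q0 1" and ?znull = "zeta H0 K0 Q0 0"
  have sum: "G H0 (convex hull K0) 1 = convex hull (G H0 K0 1) + convex hull (G H0 K0 0)"
    using assms by (intro G_convex_hull_1)
  obtain a where a: "a \<in> G H0 K0 1"
    using assms(2) by blast
  \<comment> \<open>In \<open>ereal\<close>, \<infinity> + (-\<infinity>) is \<infinity>. Excluding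
    the value \<infinity> here keeps the equivalence in (iii) correct when \<open>?znull\<close> is
    -\<infinity>.\<close>
  have z1: "?zone < \<infinity>"
    using INF_lower[OF a, of "\<lambda>x. ereal (inner Q0 x)"] by (auto simp: zeta_def intro: le_less_trans)
  have "0 \<in> K0"
    using a assms(1) cone_contains_0[of K0] by (auto simp: G_def)
  then have zero: "0 \<in> G H0 K0 0"
    by (simp add: G_def)
  have z0: "?znull = (if \<forall>x\<in>G H0 K0 0. 0 \<le> inner Q0 x then 0 else -\<infinity>)"
    unfolding zeta_def using INF_inner_cone[OF cone_G_0[OF assms(1)]] zero by blast
  have lower: "?zone + ?znull \<le> ?zhull"
    unfolding zeta_def[of _ "convex hull K0"]
  proof (rule INF_greatest)
    fix x assume "x \<in> G H0 (convex hull K0) 1"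
    then obtain y b where "x = y + b" "y \<in> convex hull (G H0 K0 1)" "b \<in> convex hull (G H0 K0 0)"
      unfolding sum by (auto elim: set_plus_elim)
    then show "?zone + ?znull \<le> ereal (inner Q0 x)"
      using INF_inner_le_convex_hull[of y "G H0 K0 1" Q0] INF_inner_le_convex_hull[of b "G H0 K0 0" Q0]
        add_mono[of ?zone "ereal (inner Q0 y)" ?znull "ereal (inner Q0 b)"]
      by (simp add: zeta_def inner_add_right)
  qed
  have upper: "?zhull \<le> ereal (inner Q0 y) + ereal (inner Q0 b)"
    if "y \<in> G H0 K0 1" "b \<in> G H0 K0 0" for y b
  proof -
    have "y + b \<in> G H0 (convex hull K0) 1"
      unfolding sum using that by (intro set_plus_intro hull_inc)
    then show ?thesis
      unfolding zeta_def by (rule INF_lower2) (simp add: inner_add_right)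
  qed
  have "?zhull \<le> ?zone + ?znull"
  \<comment> \<open>If \<open>?znull\<close> is 0, taking \<open>b = 0\<close> in
    \<open>upper\<close> suffices. Otherwise \<open>y\<close> is fixed at \<open>a\<close> while
    \<open>b\<close> varies: the finite value at \<open>a\<close> cannot offset values unbounded
    below, so \<open>?zhull\<close> is -\<infinity>.\<close>
  proof (cases "?znull = 0")
    case True
    have "?zhull \<le> ereal (inner Q0 y)" if "y \<in> G H0 K0 1" for y
      using upper[OF that zero] by simp
    then have "?zhull \<le> ?zone"
      unfolding zeta_def[of _ K0] by (intro INF_greatest)
    then show ?thesis
      using True by simp
  next
    case False
    then have "?znull = -\<infinity>"
      using z0 by (auto split: if_splits)
    have "?zhull - ereal (inner Q0 a) \<le> ereal (inner Q0 b)" if "b \<in> G H0 K0 0" for b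
      using upper[OF a that] by (cases ?zhull) auto
    then have "?zhull - ereal (inner Q0 a) \<le> ?znull"
      unfolding zeta_def[of _ K0 _ 0] by (intro INF_greatest)
    then have "?zhull = -\<infinity>"
      using \<open>?znull = -\<infinity>\<close> by (cases ?zhull) auto
    then show ?thesis
      by simp
  qed
  with lower have "?zhull = ?zone + ?znull"
    by (rule antisym[rotated])
  \<comment> \<open>For finite \<open>?zone\<close>, adding 0 or -\<infinity> changes nothing
    exactly when the summand is 0; for \<open>?zone\<close> equal to -\<infinity>, neither summand
    changes it.\<close>
  moreover have "?zone + ?znull = ?zone \<longleftrightarrow> ?znull \<ge> 0 \<or> ?zone = -\<infinity>"
    using z0 z1 by (cases ?zone) (auto split: if_splits)
  ultimately show ?thesis
    using sum by simp
qed

end
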